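(* For every integer $n\geq3$, \begin{align*} CP_{(3,1)}(n)=&\frac{1+q^{2n-3}+q^{2n-2}+q^{2n-1}}{(1-q^{2n-1})(1-q^{2n})}CP_{(3,1)}(n-1) -\frac{q^{4n-5}+q^{4n-6}+q^{4n-7}}{(1-q^{2n-3})(1-q^{2n-2})(1-q^{2n-1})(1-q^{2n})}CP_{(3,1)}(n-2)\\ &-\frac{q^{4n-8}}{(1-q^{2n-5})(1-q^{2n-3})(1-q^{2n-2})(1-q^{2n-1})(1-q^{2n})}CP_{(3,1)}(n-3). \end{align*}
   Context: A cylindric partition with profile $(c_1,c_2)$ is a pair of partitions $(\lambda^{(1)},\lambda^{(2)})$ (parts weakly decreasing, $\lambda^{(i)}_j=0$ beyond the number of parts) with $\lambda^{(1)}_j\ge\lambda^{(2)}_{j+c_2}$ and $\lambda^{(2)}_j\ge\lambda^{(1)}_{j+c_1}$ for all $j\ge1$; its size is $|\lambda^{(1)}|+|\lambda^{(2)}|$. $CP_{(3,1)}(n)$ is the generating function $\sum q^{\text{size}}$ over cylindric partitions of profile $(3,1)$ in which each partition has at most $n$ parts, with $CP_{(3,1)}(0)=1$. *)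

theory Defs
  imports "HOL-Computational_Algebra.Formal_Power_Series"
begin

text \<open>A partition is the list of its (positive) parts in weakly decreasing order.\<close>

definition is_partition :: "nat list \<Rightarrow> bool" where
  "is_partition p \<longleftrightarrow> sorted_wrt (\<ge>) p \<and> (\<forall>x\<in>set p. 0 < x)"

text \<open>Parts are numbered from 1, so \<open>part p j\<close> is only meaningful for \<open>j \<ge> 1\<close>.\<close>

definition part :: "nat list \<Rightarrow> nat \<Rightarrow> nat" where
  "part p j = (if 1 \<le> j \<and> j \<le> length p then p ! (j - 1) else 0)"

definition cylindric_partition :: "nat \<Rightarrow> nat \<Rightarrow> nat list \<times> nat list \<Rightarrow> bool" where
  "cylindric_partition c1 c2 = (\<lambda>(p1, p2).
     is_partition p1 \<and> is_partition p2 \<and>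
     (\<forall>j\<ge>1. part p1 j \<ge> part p2 (j + c2)) \<and>
     (\<forall>j\<ge>1. part p2 j \<ge> part p1 (j + c1)))"

definition cp_size :: "nat list \<times> nat list \<Rightarrow> nat" where
  "cp_size = (\<lambda>(p1, p2). sum_list p1 + sum_list p2)"

definition cylindric_partitions ::
    "nat \<Rightarrow> nat \<Rightarrow> nat \<Rightarrow> nat \<Rightarrow> (nat list \<times> nat list) set" where
  "cylindric_partitions c1 c2 n m =
     {(p1, p2). cylindric_partition c1 c2 (p1, p2) \<and>
        length p1 \<le> n \<and> length p2 \<le> n \<and> cp_size (p1, p2) = m}"

lemma finite_cylindric_partitions: "finite (cylindric_partitions c1 c2 n m)"
proof (rule finite_subset)
  let ?L = "{xs. set xs \<subseteq> {..m} \<and> length xs \<le> n}"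
  show "cylindric_partitions c1 c2 n m \<subseteq> ?L \<times> ?L"
    by (auto simp: cylindric_partitions_def cp_size_def
        dest!: member_le_sum_list)
  show "finite (?L \<times> ?L)"
    by (intro finite_cartesian_product finite_lists_length_le) auto
qed

text \<open>Rational coefficients are used so that power series can be divided by \<open>1 - q ^ k\<close>.\<close>

definition CP :: "nat \<Rightarrow> nat \<Rightarrow> nat \<Rightarrow> rat fps" where
  "CP c1 c2 n = Abs_fps (\<lambda>m. of_nat (card (cylindric_partitions c1 c2 n m)))"

lemma CP_0: "CP c1 c2 0 = 1"
proof (rule fps_ext)
  fix m
  have "cylindric_partitions c1 c2 0 m = (if m = 0 then {([], [])} else {})"
    by (auto simp: cylindric_partitions_def cylindric_partition_def cp_size_def
        is_partition_def part_def)
  then show "fps_nth (CP c1 c2 0) m = fps_nth 1 m"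
    by (simp add: CP_def)
qed

end

theory Submission
  imports Defs
begin

text \<open>Bound the number of parts of the two partitions separately, by \<open>i\<close> and \<open>j\<close>, and let
\<open>G i j\<close> be the resulting generating function. If \<open>j \<le> i + c2\<close> and \<open>i \<le> j + c1\<close>, then removing 1
from every part is a bijection from the pairs with exactly \<open>i\<close> and \<open>j\<close> parts onto all pairs counted
by \<open>G i j\<close>, so inclusion-exclusion gives
\<open>(1 - q^(i+j)) G i j = G (i-1) j + G i (j-1) - G (i-1) (j-1)\<close>; on the two boundary lines only one
term survives on the right. For profile \<open>(3,1)\<close> only \<open>-1 \<le> i - j \<le> 3\<close> occurs. After
multiplication of \<open>G i j\<close> by \<open>(1 - q) \<cdots> (1 - q^(i+j))\<close>, the functions \<open>A n\<close>, \<open>B n\<close>, \<open>D n\<close>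
belonging to \<open>(n,n)\<close>, \<open>(n+2,n)\<close>, \<open>(n+1,n)\<close> satisfy \<open>A (n+1) = D n + q^(2n+1) A n\<close>,
\<open>B (n+1) = D (n+1) + q^(2n+3) B n\<close> and \<open>D (n+1) = A (n+1) + B n - (1 - q^(2n+2)) D n\<close>.
Eliminating \<open>B\<close> and \<open>D\<close> leaves the recurrence for \<open>A\<close>.\<close>

section \<open>Generating functions of pairs with separately bounded lengths\<close>

definition cyl_le :: "nat \<Rightarrow> nat \<Rightarrow> nat \<Rightarrow> nat \<Rightarrow> (nat list \<times> nat list) set" where
  "cyl_le c1 c2 i j =
     {(p1, p2). cylindric_partition c1 c2 (p1, p2) \<and> length p1 \<le> i \<and> length p2 \<le> j}"

definition cyl_eq :: "nat \<Rightarrow> nat \<Rightarrow> nat \<Rightarrow> nat \<Rightarrow> (nat list \<times> nat list) set" where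
  "cyl_eq c1 c2 i j =
     {(p1, p2). cylindric_partition c1 c2 (p1, p2) \<and> length p1 = i \<and> length p2 = j}"

definition size_gf :: "(nat list \<times> nat list) set \<Rightarrow> rat fps" where
  "size_gf S = Abs_fps (\<lambda>m. of_nat (card {p \<in> S. cp_size p = m}))"

lemma CP_eq_size_gf: "CP c1 c2 n = size_gf (cyl_le c1 c2 n n)"
proof -
  have "cylindric_partitions c1 c2 n m = {p \<in> cyl_le c1 c2 n n. cp_size p = m}" for m
    by (auto simp: cylindric_partitions_def cyl_le_def)
  then show ?thesis
    by (simp add: CP_def size_gf_def)
qed

lemma finite_cyl_le_size: "finite {p \<in> cyl_le c1 c2 i j. cp_size p = m}"
  by (rule finite_subset[OF _ finite_cylindric_partitions[of c1 c2 "max i j" m]])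
    (auto simp: cylindric_partitions_def cyl_le_def)

text \<open>Inclusion-exclusion in each size. Containment in a common \<open>cyl_le\<close> makes
  every size class finite, so that \<open>card\<close> really counts.\<close>

lemma size_gf_Un:
  assumes "S \<subseteq> cyl_le c1 c2 i j" "T \<subseteq> cyl_le c1 c2 i j"
  shows "size_gf (S \<union> T) = size_gf S + size_gf T - size_gf (S \<inter> T)"
proof (rule fps_ext)
  fix m
  let ?L = "\<lambda>S. {p \<in> S. cp_size p = m}"
  have fin: "finite (?L S)" "finite (?L T)"
    using assms by (auto intro: finite_subset[OF _ finite_cyl_le_size[of c1 c2 i j m]])
  have "?L (S \<union> T) = ?L S \<union> ?L T" "?L (S \<inter> T) = ?L S \<inter> ?L T"
    by auto
  then have "card (?L S) + card (?L T) = card (?L (S \<union> T)) + card (?L (S \<inter> T))"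
    using card_Un_Int[OF fin] by simp
  then have "(of_nat (card (?L S)) + of_nat (card (?L T)) :: rat) =
      of_nat (card (?L (S \<union> T))) + of_nat (card (?L (S \<inter> T)))"
    by (simp flip: of_nat_add)
  then show "fps_nth (size_gf (S \<union> T)) m = fps_nth (size_gf S + size_gf T - size_gf (S \<inter> T)) m"
    by (simp add: size_gf_def)
qed

lemma size_gf_empty: "size_gf {} = 0"
  by (simp add: size_gf_def fps_eq_iff)

section \<open>Adding 1 to every part, and the inverse operation\<close>

definition raise_parts :: "nat \<Rightarrow> nat list \<Rightarrow> nat list" where
  "raise_parts k p = map Suc p @ replicate (k - length p) 1"

text \<open>Parts equal to 1 become 0 and are dropped. \<open>raise_parts\<close> restores them as
  the padding by ones, which is why it takes the target length \<open>k\<close>.\<close>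

definition lower_parts :: "nat list \<Rightarrow> nat list" where
  "lower_parts p = filter (\<lambda>x. 0 < x) (map (\<lambda>x. x - 1) p)"

lemma length_raise_parts: "length p \<le> k \<Longrightarrow> length (raise_parts k p) = k"
  by (simp add: raise_parts_def)

lemma sum_list_raise_parts: "length p \<le> k \<Longrightarrow> sum_list (raise_parts k p) = sum_list p + k"
proof -
  have "sum_list (map Suc p) = sum_list p + length p"
    by (induction p) auto
  then show "length p \<le> k \<Longrightarrow> ?thesis"
    by (simp add: raise_parts_def sum_list_replicate)
qed

lemma part_raise_parts:
  "length p \<le> k \<Longrightarrow> part (raise_parts k p) j = (if 1 \<le> j \<and> j \<le> k then Suc (part p j) else 0)"
  by (auto simp: part_def raise_parts_def nth_append)

lemma is_partition_raise_parts: "is_partition p \<Longrightarrow> is_partition (raise_parts k p)"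
proof -
  have "sorted_wrt (\<ge>) (replicate l (Suc 0))" for l
    by (simp add: sorted_wrt_iff_nth_less)
  then show "is_partition p \<Longrightarrow> ?thesis"
    by (auto simp: is_partition_def raise_parts_def sorted_wrt_append sorted_wrt_map)
qed

lemma is_partition_lower_parts:
  assumes "is_partition p"
  shows "is_partition (lower_parts p)"
proof -
  have "sorted_wrt (\<lambda>x y. y - 1 \<le> x - 1) p"
    by (rule sorted_wrt_mono_rel[of p "(\<ge>)"]) (use assms in \<open>auto simp: is_partition_def\<close>)
  then show ?thesis
    by (auto intro!: sorted_wrt_filter simp: is_partition_def lower_parts_def sorted_wrt_map)
qed

lemma length_lower_parts: "length (lower_parts p) \<le> length p"
  by (simp add: lower_parts_def order.trans[OF length_filter_le])

lemma lower_raise_parts: "is_partition p \<Longrightarrow> lower_parts (raise_parts k p) = p"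
  by (auto simp: lower_parts_def raise_parts_def is_partition_def comp_def)

text \<open>If the head is 1, the whole list consists of ones and is recovered purely as padding.
  Otherwise the head survives the lowering and the induction hypothesis handles the tail.\<close>

lemma raise_lower_parts:
  "is_partition p \<Longrightarrow> raise_parts (length p) (lower_parts p) = p"
proof (induction p)
  case Nil
  then show ?case by (simp add: raise_parts_def lower_parts_def)
next
  case (Cons x p)
  then have p: "is_partition p" and x: "0 < x" "\<forall>y\<in>set p. 0 < y \<and> y \<le> x"
    by (auto simp: is_partition_def)
  show ?case
  proof (cases "x = 1")
    case True
    then have "\<forall>y\<in>set p. y = 1"
      using x by force
    then have "lower_parts (x # p) = []" and "p = replicate (length p) 1"
      using True by (auto simp: lower_parts_def filter_empty_conv intro: replicate_eqI)
    then show ?thesis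
      using True by (simp add: raise_parts_def)
  next
    case False
    then show ?thesis
      using Cons.IH[OF p] x by (simp add: lower_parts_def raise_parts_def)
  qed
qed

lemma length_is_partition_le:
  assumes "is_partition p" "part p (Suc k) = 0"
  shows "length p \<le> k"
proof (rule ccontr)
  assume "\<not> length p \<le> k"
  then have "p ! k \<in> set p" "part p (Suc k) = p ! k"
    by (auto simp: part_def)
  with assms show False
    by (auto simp: is_partition_def)
qed

text \<open>The first index past the end of one partition has part 0, so the cylindric inequality
  there forces a zero in the other partition.\<close>

lemma cylindric_partition_length:
  assumes "cylindric_partition c1 c2 (p1, p2)"
  shows "length p2 \<le> length p1 + c2" "length p1 \<le> length p2 + c1"
proof -
  have "part p1 (Suc (length p1)) = 0" "part p2 (Suc (length p2)) = 0"
    by (simp_all add: part_def)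
  then have "part p2 (Suc (length p1 + c2)) = 0" "part p1 (Suc (length p2 + c1)) = 0"
    using assms unfolding cylindric_partition_def
    by (metis (no_types, lifting) add_Suc case_prod_conv le_add1 le_zero_eq plus_1_eq_Suc)+
  then show "length p2 \<le> length p1 + c2" "length p1 \<le> length p2 + c1"
    using assms by (auto simp: cylindric_partition_def intro: length_is_partition_le)
qed

text \<open>Consider \<open>part p1 k\<close> \<ge> \<open>part p2 (k + c2)\<close>. If
  \<open>k + c2\<close> \<le> \<open>j\<close>, then \<open>k\<close> \<le> \<open>i\<close> by the
  bound on \<open>j\<close>, and both sides grow by 1. Otherwise the right side is 0 before and
  after raising. The other family is symmetric.\<close>

lemma cylindric_partition_raise_parts:
  assumes "is_partition p1" "is_partition p2" "length p1 \<le> i" "length p2 \<le> j"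
    and "j \<le> i + c2" "i \<le> j + c1"
  shows "cylindric_partition c1 c2 (raise_parts i p1, raise_parts j p2) \<longleftrightarrow>
    cylindric_partition c1 c2 (p1, p2)"
proof -
  have z: "part p1 k = 0" if "i < k" for k
    using that assms by (simp add: part_def)
  have z': "part p2 k = 0" if "j < k" for k
    using that assms by (simp add: part_def)
  have "part (raise_parts i p1) k \<ge> part (raise_parts j p2) (k + c2) \<longleftrightarrow>
      part p1 k \<ge> part p2 (k + c2)" if "1 \<le> k" for k
    using that assms z' by (auto simp: part_raise_parts)
  moreover have "part (raise_parts j p2) k \<ge> part (raise_parts i p1) (k + c1) \<longleftrightarrow>
      part p2 k \<ge> part p1 (k + c1)" if "1 \<le> k" for k
    using that assms z by (auto simp: part_raise_parts)
  ultimately show ?thesis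
    using assms by (auto simp: cylindric_partition_def is_partition_raise_parts)
qed

lemma size_gf_cyl_eq:
  assumes "j \<le> i + c2" "i \<le> j + c1"
  shows "size_gf (cyl_eq c1 c2 i j) = fps_X ^ (i + j) * size_gf (cyl_le c1 c2 i j)"
proof (rule fps_ext)
  fix m
  let ?f = "\<lambda>(p1, p2). (raise_parts i p1, raise_parts j p2)"
  let ?g = "\<lambda>(p1, p2). (lower_parts p1, lower_parts p2)"
  let ?E = "{p \<in> cyl_eq c1 c2 i j. cp_size p = m}"
  have part: "is_partition p1 \<and> is_partition p2" if "cylindric_partition c1 c2 (p1, p2)" for p1 p2
    using that by (simp add: cylindric_partition_def)
  have f: "?f p \<in> cyl_eq c1 c2 i j \<and> cp_size (?f p) = cp_size p + (i + j) \<and> ?g (?f p) = p"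
    if "p \<in> cyl_le c1 c2 i j" for p
    using that assms
    by (auto simp: cyl_le_def cyl_eq_def cp_size_def length_raise_parts sum_list_raise_parts
        lower_raise_parts cylindric_partition_raise_parts part)
  have g: "?g p \<in> cyl_le c1 c2 i j \<and> ?f (?g p) = p" if "p \<in> cyl_eq c1 c2 i j" for p
  proof -
    obtain p1 p2 where p: "p = (p1, p2)" by (cases p)
    have cyl: "cylindric_partition c1 c2 (p1, p2)" and len: "length p1 = i" "length p2 = j"
      using that by (auto simp: cyl_eq_def p)
    have "raise_parts i (lower_parts p1) = p1" "raise_parts j (lower_parts p2) = p2"
      using part[OF cyl] len raise_lower_parts by auto
    moreover have "length (lower_parts p1) \<le> i" "length (lower_parts p2) \<le> j"
      using len length_lower_parts by metis+
    ultimately show ?thesis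
      using cyl part[OF cyl] assms
        cylindric_partition_raise_parts[of "lower_parts p1" "lower_parts p2" i j c2 c1]
      by (simp add: p cyl_le_def is_partition_lower_parts)
  qed
  have "fps_nth (size_gf (cyl_eq c1 c2 i j)) m =
      (if m < i + j then 0 else fps_nth (size_gf (cyl_le c1 c2 i j)) (m - (i + j)))"
  proof (cases "m < i + j")
    case True
    \<comment> \<open>Here \<open>p\<close> is the raised form of \<open>?g p\<close>, and raising
      adds \<open>i + j\<close> to the size.\<close>
    have "cp_size p \<ge> i + j" if "p \<in> cyl_eq c1 c2 i j" for p
      using g[OF that] f[of "?g p"] by auto
    then have "?E = {}"
      using True by force
    then show ?thesis
      using True by (simp only: size_gf_def fps_nth_Abs_fps) simp
  next
    case False
    have "bij_betw ?f {p \<in> cyl_le c1 c2 i j. cp_size p = m - (i + j)} ?E"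
    proof (rule bij_betw_byWitness[where f' = ?g])
      show "?g ` ?E \<subseteq> {p \<in> cyl_le c1 c2 i j. cp_size p = m - (i + j)}"
      proof
        fix y assume "y \<in> ?g ` ?E"
        then obtain p where "p \<in> ?E" and y: "y = ?g p" by blast
        then show "y \<in> {p \<in> cyl_le c1 c2 i j. cp_size p = m - (i + j)}"
          using g[of p] f[of y] by simp
      qed
    qed (use f g False in auto)
    then show ?thesis
      using False bij_betw_same_card by (force simp: size_gf_def)
  qed
  then show "fps_nth (size_gf (cyl_eq c1 c2 i j)) m =
      fps_nth (fps_X ^ (i + j) * size_gf (cyl_le c1 c2 i j)) m"
    by (simp add: fps_X_power_mult_nth)
qed

section \<open>Recurrences in the two length bounds\<close>

lemma size_gf_cyl_le_Suc_Suc: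
  assumes "j \<le> i + c2" "i \<le> j + c1"
  shows "(1 - fps_X ^ (i + j + 2)) * size_gf (cyl_le c1 c2 (Suc i) (Suc j)) =
    size_gf (cyl_le c1 c2 i (Suc j)) + size_gf (cyl_le c1 c2 (Suc i) j) - size_gf (cyl_le c1 c2 i j)"
proof -
  let ?L = "cyl_le c1 c2"
  let ?E = "cyl_eq c1 c2 (Suc i) (Suc j)"
  have un: "?L (Suc i) (Suc j) = (?L i (Suc j) \<union> ?L (Suc i) j) \<union> ?E"
    by (auto simp: cyl_le_def cyl_eq_def)
  have int: "?L i (Suc j) \<inter> ?L (Suc i) j = ?L i j" "(?L i (Suc j) \<union> ?L (Suc i) j) \<inter> ?E = {}"
    by (auto simp: cyl_le_def cyl_eq_def)
  have "size_gf (?L (Suc i) (Suc j)) =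
      size_gf (?L i (Suc j) \<union> ?L (Suc i) j) + size_gf ?E - size_gf {}"
    unfolding un int(2)[symmetric]
    by (rule size_gf_Un[of _ c1 c2 "Suc i" "Suc j"]) (auto simp: cyl_le_def cyl_eq_def)
  moreover have "size_gf (?L i (Suc j) \<union> ?L (Suc i) j) =
      size_gf (?L i (Suc j)) + size_gf (?L (Suc i) j) - size_gf (?L i j)"
    unfolding int(1)[symmetric]
    by (rule size_gf_Un[of _ c1 c2 "Suc i" "Suc j"]) (auto simp: cyl_le_def)
  moreover have "size_gf ?E = fps_X ^ (i + j + 2) * size_gf (?L (Suc i) (Suc j))"
    using size_gf_cyl_eq[of "Suc j" "Suc i" c2 c1] assms by simp
  ultimately show ?thesis
    by (simp add: size_gf_empty algebra_simps)
qed

text \<open>If the second partition has the full \<open>Suc j = i + c2\<close> parts, the first must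
  have at least \<open>i\<close>, hence exactly \<open>i\<close>. So the pairs lost on lowering the
  bound to \<open>j\<close> are exactly \<open>cyl_eq c1 c2 i (Suc j)\<close>.\<close>

lemma size_gf_cyl_le_right_boundary:
  assumes "Suc j = i + c2"
  shows "(1 - fps_X ^ (i + Suc j)) * size_gf (cyl_le c1 c2 i (Suc j)) = size_gf (cyl_le c1 c2 i j)"
proof (cases "i \<le> Suc j + c1")
  case True
  have un: "cyl_le c1 c2 i (Suc j) = cyl_le c1 c2 i j \<union> cyl_eq c1 c2 i (Suc j)"
    using assms by (fastforce simp: cyl_le_def cyl_eq_def dest: cylindric_partition_length(1))
  have int: "cyl_le c1 c2 i j \<inter> cyl_eq c1 c2 i (Suc j) = {}"
    by (auto simp: cyl_le_def cyl_eq_def)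
  have "size_gf (cyl_le c1 c2 i (Suc j)) =
      size_gf (cyl_le c1 c2 i j) + size_gf (cyl_eq c1 c2 i (Suc j)) - size_gf {}"
    unfolding un int[symmetric]
    by (rule size_gf_Un[of _ c1 c2 i "Suc j"]) (auto simp: cyl_le_def cyl_eq_def)
  then show ?thesis
    using size_gf_cyl_eq[of "Suc j" i c2 c1] assms True by (simp add: size_gf_empty algebra_simps)
qed (use assms in simp)

lemma size_gf_cyl_le_left_boundary:
  assumes "Suc i = j + c1"
  shows "(1 - fps_X ^ (Suc i + j)) * size_gf (cyl_le c1 c2 (Suc i) j) = size_gf (cyl_le c1 c2 i j)"
proof (cases "j \<le> Suc i + c2")
  case True
  have un: "cyl_le c1 c2 (Suc i) j = cyl_le c1 c2 i j \<union> cyl_eq c1 c2 (Suc i) j"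
    using assms by (fastforce simp: cyl_le_def cyl_eq_def dest: cylindric_partition_length(2))
  have int: "cyl_le c1 c2 i j \<inter> cyl_eq c1 c2 (Suc i) j = {}"
    by (auto simp: cyl_le_def cyl_eq_def)
  have "size_gf (cyl_le c1 c2 (Suc i) j) =
      size_gf (cyl_le c1 c2 i j) + size_gf (cyl_eq c1 c2 (Suc i) j) - size_gf {}"
    unfolding un int[symmetric]
    by (rule size_gf_Un[of _ c1 c2 "Suc i" j]) (auto simp: cyl_le_def cyl_eq_def)
  then show ?thesis
    using size_gf_cyl_eq[of j "Suc i" c2 c1] assms True by (simp add: size_gf_empty algebra_simps)
qed (use assms in simp)

section \<open>Clearing denominators with the q-Pochhammer symbol (q;q)_m, and elimination\<close>

definition q_fact :: "nat \<Rightarrow> rat fps" where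
  "q_fact m = (\<Prod>k<m. 1 - fps_X ^ Suc k)"

lemma q_fact_Suc: "q_fact (Suc m) = q_fact m * (1 - fps_X ^ Suc m)"
  by (simp add: q_fact_def)

lemma one_minus_fps_X_power_nonzero: "0 < k \<Longrightarrow> 1 - fps_X ^ k \<noteq> (0 :: rat fps)"
proof
  assume "0 < k" "1 - fps_X ^ k = (0 :: rat fps)"
  then have "fps_nth (1 - fps_X ^ k) 0 = (0 :: rat)" by simp
  with \<open>0 < k\<close> show False by (simp add: fps_X_power_nth)
qed

lemma q_fact_nonzero: "q_fact m \<noteq> 0"
  unfolding q_fact_def prod_zero_iff[OF finite_lessThan]
  using one_minus_fps_X_power_nonzero by blast

definition cyl_num :: "nat \<Rightarrow> nat \<Rightarrow> rat fps" where
  "cyl_num i j = q_fact (i + j) * size_gf (cyl_le 3 1 i j)"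

text \<open>The indices (i,j) have sum one less than those of the other two terms on the right, so
  one factor of \<open>q_fact\<close> remains in front of \<open>cyl_num i j\<close>.\<close>

lemma cyl_num_Suc_Suc:
  assumes "j \<le> i + 1" "i \<le> j + 3"
  shows "cyl_num (Suc i) (Suc j) =
    cyl_num i (Suc j) + cyl_num (Suc i) j - (1 - fps_X ^ Suc (i + j)) * cyl_num i j"
proof -
  have "cyl_num (Suc i) (Suc j) = q_fact (Suc (i + j)) *
      ((1 - fps_X ^ (i + j + 2)) * size_gf (cyl_le 3 1 (Suc i) (Suc j)))"
    by (simp add: cyl_num_def q_fact_Suc mult_ac)
  also have "\<dots> = cyl_num i (Suc j) + cyl_num (Suc i) j - (1 - fps_X ^ Suc (i + j)) * cyl_num i j"
    unfolding size_gf_cyl_le_Suc_Suc[OF assms]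
    by (simp add: cyl_num_def q_fact_Suc algebra_simps)
  finally show ?thesis .
qed

lemma cyl_num_right_boundary: "cyl_num i (Suc i) = cyl_num i i"
proof -
  have "cyl_num i (Suc i) =
      q_fact (i + i) * ((1 - fps_X ^ (i + Suc i)) * size_gf (cyl_le 3 1 i (Suc i)))"
    unfolding cyl_num_def add_Suc_right q_fact_Suc by (rule mult.assoc)
  also have "\<dots> = cyl_num i i"
    by (subst size_gf_cyl_le_right_boundary) (simp_all add: cyl_num_def)
  finally show ?thesis .
qed

lemma cyl_num_left_boundary:
  assumes "Suc i = j + 3"
  shows "cyl_num (Suc i) j = cyl_num i j"
proof -
  have "cyl_num (Suc i) j =
      q_fact (i + j) * ((1 - fps_X ^ (Suc i + j)) * size_gf (cyl_le 3 1 (Suc i) j))"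
    unfolding cyl_num_def add_Suc q_fact_Suc by (rule mult.assoc)
  also have "\<dots> = cyl_num i j"
    by (subst size_gf_cyl_le_left_boundary[OF assms]) (simp add: cyl_num_def)
  finally show ?thesis .
qed

lemma cyl_num_recurrence:
  "cyl_num (n + 3) (n + 3) =
    (1 + fps_X ^ (2*n+3) + fps_X ^ (2*n+4) + fps_X ^ (2*n+5)) * cyl_num (n + 2) (n + 2)
    - (fps_X ^ (4*n+7) + fps_X ^ (4*n+6) + fps_X ^ (4*n+5)) * cyl_num (n + 1) (n + 1)
    - fps_X ^ (4*n+4) * (1 - fps_X ^ (2*n+2)) * cyl_num n n"
proof -
  define x :: "rat fps" where "x = fps_X ^ n"
  define A where "A k = cyl_num k k" for k
  define B where "B k = cyl_num (k + 2) k" for k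
  define D where "D k = cyl_num (k + 1) k" for k
  have exponent: "Suc (k + k) = 2*k+1" "Suc (k + 2 + k) = 2*k+3" "Suc (k + 1 + k) = 2*k+2" for k :: nat
    by simp_all
  \<comment> \<open>The term \<open>cyl_num k (k + 1)\<close> lies on the right boundary and equals
    \<open>A k\<close>, cancelling the 1 in the last coefficient. In the recurrence for
    \<open>B\<close> the left boundary does the same.\<close>
  have A: "A (k + 1) = D k + fps_X ^ (2*k+1) * A k" for k
    using cyl_num_Suc_Suc[of k k] cyl_num_right_boundary[of k]
    unfolding A_def D_def exponent by (simp add: algebra_simps del: power_Suc)
  have B: "B (k + 1) = D (k + 1) + fps_X ^ (2*k+3) * B k" for k
    using cyl_num_Suc_Suc[of k "k + 2"] cyl_num_left_boundary[of "k + 2" k]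
    unfolding B_def D_def exponent by (simp add: algebra_simps del: power_Suc)
  have D: "D (k + 1) = A (k + 1) + B k - (1 - fps_X ^ (2*k+2)) * D k" for k
    using cyl_num_Suc_Suc[of k "k + 1"]
    unfolding A_def B_def D_def exponent by (simp add: del: power_Suc)
  \<comment> \<open>Writing the powers through \<open>x\<close> = q^n turns the final claim into a
    polynomial identity in \<open>x\<close>, q and the values of \<open>A\<close>.\<close>
  have pow: "fps_X ^ (2*n+k) = x^2 * fps_X ^ k" "fps_X ^ (4*n+k) = x^4 * fps_X ^ k" for k
    by (simp_all add: x_def power_add mult.commute flip: power_mult)
  have eqs: "D n = A (n+1) - fps_X ^ (2*n+1) * A n"
    "D (n+1) = A (n+2) - fps_X ^ (2*n+3) * A (n+1)"
    "D (n+2) = A (n+3) - fps_X ^ (2*n+5) * A (n+2)"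
    "B n = D (n+1) - A (n+1) + (1 - fps_X ^ (2*n+2)) * D n"
    "B (n+1) = D (n+2) - A (n+2) + (1 - fps_X ^ (2*n+4)) * D (n+1)"
    using A[of n] A[of "n+1"] A[of "n+2"] D[of n] D[of "n+1"]
    by (simp_all add: eval_nat_numeral)
  \<comment> \<open>Everything in this relation can be expressed by \<open>A\<close> at
    \<open>n\<close>, ..., \<open>n+3\<close>; substituting \<open>eqs\<close> gives the
    recurrence.\<close>
  have "B (n+1) - D (n+1) - fps_X ^ (2*n+3) * B n = 0"
    using B[of n] by simp
  then show ?thesis
    unfolding eqs pow A_def[symmetric] by (simp add: algebra_simps eval_nat_numeral)
qed

section \<open>Returning from the numerators to \<open>CP\<close>\<close>

theorem theorem5p4:
  fixes n :: nat
  assumes "n \<ge> 3"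
  shows "let q = (fps_X :: rat fps) in
    CP 3 1 n =
      (1 + q ^ (2*n-3) + q ^ (2*n-2) + q ^ (2*n-1))
        / ((1 - q ^ (2*n-1)) * (1 - q ^ (2*n))) * CP 3 1 (n-1)
      - (q ^ (4*n-5) + q ^ (4*n-6) + q ^ (4*n-7))
        / ((1 - q ^ (2*n-3)) * (1 - q ^ (2*n-2)) * (1 - q ^ (2*n-1)) * (1 - q ^ (2*n)))
        * CP 3 1 (n-2)
      - q ^ (4*n-8)
        / ((1 - q ^ (2*n-5)) * (1 - q ^ (2*n-3)) * (1 - q ^ (2*n-2)) * (1 - q ^ (2*n-1))
           * (1 - q ^ (2*n)))
        * CP 3 1 (n-3)"
proof -
  \<comment> \<open>This shift removes the truncated subtractions: 2n-5, ..., 2n become 2k+1, ...,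
    2k+6, the exponents in \<open>u 1\<close>, ..., \<open>u 6\<close>.\<close>
  define k where "k = n - 3"
  then have n: "n = k + 3"
    using assms by simp
  define u where "u i = 1 - (fps_X :: rat fps) ^ (2*k+i)" for i
  have u: "u i * inverse (u i) = 1" if "0 < i" for i
    using that by (intro inverse_mult_eq_1') (simp add: u_def fps_X_power_nth)
  have unit: "fps_nth (u i) 0 \<noteq> 0" if "0 < i" for i
    using that by (simp add: u_def fps_X_power_nth)
  define N1 :: "rat fps" where "N1 = 1 + fps_X ^ (2*k+3) + fps_X ^ (2*k+4) + fps_X ^ (2*k+5)"
  define N2 :: "rat fps" where "N2 = fps_X ^ (4*k+7) + fps_X ^ (4*k+6) + fps_X ^ (4*k+5)"
  define N3 :: "rat fps" where "N3 = fps_X ^ (4*k+4)"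
  define C where "C i = CP 3 1 (k + i)" for i
  define Q where "Q = q_fact (2*k)"
  have A: "cyl_num (k + i) (k + i) = q_fact (2*k + 2*i) * C i" for i
  proof -
    have "2*k + 2*i = k + i + (k + i)"
      by simp
    then show ?thesis
      by (simp only: cyl_num_def C_def CP_eq_size_gf)
  qed
  have Q: "q_fact (2*k + 2) = Q * u 1 * u 2" "q_fact (2*k + 4) = Q * u 1 * u 2 * u 3 * u 4"
    "q_fact (2*k + 6) = Q * u 1 * u 2 * u 3 * u 4 * u 5 * u 6"
    by (simp_all add: Q_def u_def numeral_eq_Suc q_fact_Suc del: power_Suc)
  have num: "cyl_num k k = Q * C 0" "cyl_num (k + 1) (k + 1) = q_fact (2*k + 2) * C 1"
    "cyl_num (k + 2) (k + 2) = q_fact (2*k + 4) * C 2"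
    "cyl_num (k + 3) (k + 3) = q_fact (2*k + 6) * C 3"
    using A[of 0] A[of 1] A[of 2] A[of 3] by (simp_all add: Q_def)
  have "cyl_num (k + 3) (k + 3) = N1 * cyl_num (k + 2) (k + 2)
      - N2 * cyl_num (k + 1) (k + 1) - N3 * u 2 * cyl_num k k"
    unfolding N1_def N2_def N3_def u_def by (rule cyl_num_recurrence)
  \<comment> \<open>The last term has a factor \<open>u 2\<close> from the recurrence, the others
    from \<open>q_fact\<close>. Cancelling it explains why 1 - q^(2n-4) is absent from all
    denominators.\<close>
  then have "Q * u 2 * (u 1 * u 3 * u 4 * u 5 * u 6 * C 3) =
      Q * u 2 * (N1 * (u 1 * u 3 * u 4) * C 2 - N2 * u 1 * C 1 - N3 * C 0)"
    unfolding num Q by (simp add: algebra_simps)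
  moreover have "Q * u 2 \<noteq> 0"
    using q_fact_nonzero unit[of 2] by (auto simp: Q_def)
  ultimately have main: "u 1 * u 3 * u 4 * u 5 * u 6 * C 3 =
      N1 * (u 1 * u 3 * u 4) * C 2 - N2 * u 1 * C 1 - N3 * C 0"
    using mult_left_cancel by blast
  define v where "v i = inverse (u i)" for i
  \<comment> \<open>Each \<open>u i\<close> with \<open>i\<close> > 0 has constant term 1 and is a
    unit. Inserting the products \<open>u i * v i\<close> reduces the division to ring
    rewriting.\<close>
  have "C 3 = (u 1 * v 1) * (u 3 * v 3) * (u 4 * v 4) * (u 5 * v 5) * (u 6 * v 6) * C 3"
    by (simp add: u v_def)
  also have "\<dots> = (u 1 * u 3 * u 4 * u 5 * u 6 * C 3) * (v 1 * v 3 * v 4 * v 5 * v 6)"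
    by (simp only: mult_ac)
  also have "\<dots> = N1 * ((u 1 * v 1) * (u 3 * v 3) * (u 4 * v 4)) * (v 5 * v 6) * C 2
      - N2 * (u 1 * v 1) * (v 3 * v 4 * v 5 * v 6) * C 1 - N3 * (v 1 * v 3 * v 4 * v 5 * v 6) * C 0"
    unfolding main by (simp only: algebra_simps)
  also have "\<dots> = N1 / (u 5 * u 6) * C 2 - N2 / (u 3 * u 4 * u 5 * u 6) * C 1
      - N3 / (u 1 * u 3 * u 4 * u 5 * u 6) * C 0"
    by (simp add: u v_def unit fps_divide_unit fps_inverse_mult)
  finally have "C 3 = N1 / (u 5 * u 6) * C 2 - N2 / (u 3 * u 4 * u 5 * u 6) * C 1
      - N3 / (u 1 * u 3 * u 4 * u 5 * u 6) * C 0" .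
  then show ?thesis
    by (simp add: n Let_def C_def u_def N1_def N2_def N3_def algebra_simps)
qed

end
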